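(* Consider the soft-thresholding estimator $\hat\theta_S$ with $\eta_n\to0$ and $n^{1/2}\eta_n\to\infty$. Let $\theta_n\in\mathbb{R}$ be such that $n^{1/2}\theta_n\to\nu\in\mathbb{R}\cup\{-\infty,\infty\}$. Then $F_{S,n,\theta_n}$ approaches pointmass at $-\nu$: in case $|\nu|<\infty$, $F_{S,n,\theta_n}$ converges weakly to pointmass at $-\nu$; in case $|\nu|=\infty$, the total mass of $F_{S,n,\theta_n}$ escapes to $-\nu$, in the sense that $F_{S,n,\theta_n}(x)\to0$ for every $x\in\mathbb{R}$ if $-\nu=\infty$, and $F_{S,n,\theta_n}(x)\to1$ for every $x\in\mathbb{R}$ if $-\nu=-\infty$.
   Context: For each $n\ge1$ and $\theta\in\mathbb{R}$, $P_{n,\theta}$ is the probability measure under which $y_1,\dots,y_n$ are independent and each $N(\theta,1)$-distributed; $\bar y=n^{-1}\sum_{t=1}^n y_t$. $(\eta_n)$ is a sequence of positive real numbers, and $\hat\theta_S=\mathrm{sign}(\bar y)(|\bar y|-\eta_n)_+$, where $z_+=\max\{z,0\}$ and $\mathrm{sign}(x)=-1,0,1$ for $x<0$, $x=0$, $x>0$. $F_{S,n,\theta}$ denotes the distribution (and its cdf) of $n^{1/2}(\hat\theta_S-\theta)$ under $P_{n,\theta}$. *)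

theory Defs
  imports "HOL-Probability.Probability"
begin

text \<open>
  The sample \<open>y\<^sub>1, \<dots>, y\<^sub>n\<close> lives on the canonical product space: a sample point is
  itself the function \<open>y\<close> on \<open>{1..n}\<close>, and \<open>y\<^sub>t\<close> is the \<open>t\<close>-th coordinate projection.
\<close>
definition sample_measure :: "nat \<Rightarrow> real \<Rightarrow> (nat \<Rightarrow> real) measure" where
  "sample_measure n \<theta> = (\<Pi>\<^sub>M t\<in>{1..n}. density lborel (normal_density \<theta> 1))"

definition sample_mean :: "nat \<Rightarrow> (nat \<Rightarrow> real) \<Rightarrow> real" where
  "sample_mean n y = (\<Sum>t=1..n. y t) / real n"

definition soft_threshold :: "real \<Rightarrow> real \<Rightarrow> real" where
  "soft_threshold \<eta> z = sgn z * max (\<bar>z\<bar> - \<eta>) 0"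

definition soft_estimator :: "(nat \<Rightarrow> real) \<Rightarrow> nat \<Rightarrow> (nat \<Rightarrow> real) \<Rightarrow> real" where
  "soft_estimator \<eta> n y = soft_threshold (\<eta> n) (sample_mean n y)"

definition soft_dist :: "(nat \<Rightarrow> real) \<Rightarrow> nat \<Rightarrow> real \<Rightarrow> real measure" where
  "soft_dist \<eta> n \<theta> =
     distr (sample_measure n \<theta>) borel (\<lambda>y. sqrt (real n) * (soft_estimator \<eta> n y - \<theta>))"

lemma prob_space_sample_measure: "prob_space (sample_measure n \<theta>)"
  unfolding sample_measure_def
  by (intro prob_space_PiM prob_space_normal_density) simp

lemma measurable_coordinate:
  "t \<in> {1..n} \<Longrightarrow> (\<lambda>y. y t) \<in> borel_measurable (sample_measure n \<theta>)"
  unfolding sample_measure_def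
  by (rule measurable_compose[OF measurable_component_singleton]) auto

lemma distr_coordinate:
  assumes "t \<in> {1..n}"
  shows "distr (sample_measure n \<theta>) borel (\<lambda>y. y t) = density lborel (normal_density \<theta> 1)"
proof -
  let ?N = "density lborel (\<lambda>x. ennreal (normal_density \<theta> 1 x))"
  have "distr (sample_measure n \<theta>) borel (\<lambda>y. y t) = distr (sample_measure n \<theta>) ?N (\<lambda>y. y t)"
    by (rule distr_cong) auto
  also have "\<dots> = ?N"
    unfolding sample_measure_def using assms
    by (intro distr_PiM_component prob_space_normal_density) simp_all
  finally show ?thesis .
qed

lemma distributed_sample_measure:
  assumes "t \<in> {1..n}"
  shows "distributed (sample_measure n \<theta>) lborel (\<lambda>y. y t) (normal_density \<theta> 1)"
proof -
  have "distr (sample_measure n \<theta>) lborel (\<lambda>y. y t) = distr (sample_measure n \<theta>) borel (\<lambda>y. y t)"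
    by (rule distr_cong) auto
  then show ?thesis
    using measurable_coordinate[OF assms, of \<theta>] distr_coordinate[OF assms, of \<theta>]
    by (auto simp: distributed_def)
qed

lemma indep_vars_sample_measure:
  assumes "n \<ge> 1"
  shows "prob_space.indep_vars (sample_measure n \<theta>) (\<lambda>_. borel) (\<lambda>t y. y t) {1..n}"
proof -
  interpret prob_space "sample_measure n \<theta>"
    by (rule prob_space_sample_measure)
  have "distr (sample_measure n \<theta>) (\<Pi>\<^sub>M t\<in>{1..n}. borel) (\<lambda>y. \<lambda>t\<in>{1..n}. y t)
      = distr (sample_measure n \<theta>) (sample_measure n \<theta>) (\<lambda>y. y)"
    by (rule distr_cong)
      (auto simp: sample_measure_def space_PiM PiE_def extensional_restrict intro!: sets_PiM_cong)
  also have "\<dots> = (\<Pi>\<^sub>M t\<in>{1..n}. distr (sample_measure n \<theta>) borel (\<lambda>y. y t))"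
    by (subst distr_id2, simp, subst sample_measure_def)
      (intro PiM_cong refl distr_coordinate[symmetric])
  finally show ?thesis
    using assms by (subst indep_vars_iff_distr_eq_PiM') (auto intro: measurable_coordinate)
qed

lemma measurable_soft_estimator:
  "soft_estimator \<eta> n \<in> borel_measurable (sample_measure n \<theta>)"
proof -
  have [measurable]: "sample_mean n \<in> borel_measurable (sample_measure n \<theta>)"
    unfolding sample_mean_def[abs_def]
    by (intro borel_measurable_divide borel_measurable_sum measurable_coordinate) auto
  have [measurable]: "(sgn :: real \<Rightarrow> real) \<in> borel_measurable borel"
    unfolding sgn_real_def by measurable
  show ?thesis
    unfolding soft_estimator_def[abs_def] soft_threshold_def by measurable
qed

lemma real_distribution_soft_dist: "real_distribution (soft_dist \<eta> n \<theta>)"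
proof -
  interpret prob_space "sample_measure n \<theta>"
    by (rule prob_space_sample_measure)
  have [measurable]: "soft_estimator \<eta> n \<in> borel_measurable (sample_measure n \<theta>)"
    by (rule measurable_soft_estimator)
  show ?thesis
    unfolding soft_dist_def by (intro real_distribution_distr) measurable
qed

end

theory Submission
  imports Defs
begin

text \<open>
  Write \<open>Z = sqrt n * (sample_mean - \<theta>)\<close>, which is standard normal, and \<open>u = sqrt n * \<theta>\<close>.
  Soft thresholding moves a number towards \<open>0\<close> by the threshold, so the normalised estimation error
  lies between \<open>min (Z + sqrt n * \<eta>) (- u)\<close> and \<open>max (Z - sqrt n * \<eta>) (- u)\<close>. For \<open>x < - u\<close> the
  error can be at most \<open>x\<close> only if \<open>Z \<le> x - sqrt n * \<eta>\<close>, and for \<open>x > - u\<close> it can exceed \<open>x\<close> only if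
  \<open>Z > x + sqrt n * \<eta>\<close>; by Chebyshev both events are asymptotically negligible. Hence the cdf tends
  to \<open>0\<close> at every point eventually below \<open>- u\<close> and to \<open>1\<close> at every point eventually above it, which
  covers finite and infinite limits of \<open>u\<close> simultaneously.
\<close>

text \<open>Equality holds for \<open>z \<ge> 0\<close>, and for \<open>z < 0\<close> the left side
  is nonpositive. The use: a positive thresholded value lies at least \<open>\<eta>\<close> below
  \<open>z\<close>.\<close>

lemma soft_threshold_le:
  assumes "\<eta> \<ge> 0"
  shows "soft_threshold \<eta> z \<le> max (z - \<eta>) 0"
  using assms by (auto simp: soft_threshold_def sgn_real_def max_def)

lemma soft_threshold_ge:
  assumes "\<eta> \<ge> 0"
  shows "soft_threshold \<eta> z \<ge> min (z + \<eta>) 0"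
  using assms by (auto simp: soft_threshold_def sgn_real_def max_def min_def)

lemma borel_measurable_sample_mean:
  "sample_mean n \<in> borel_measurable (sample_measure n \<theta>)"
  unfolding sample_mean_def[abs_def]
  by (intro borel_measurable_divide borel_measurable_sum measurable_coordinate) auto

text \<open>A sum of independent normals is normal, with means and variances adding up to
  \<open>n * \<theta>\<close> and \<open>n\<close>; centring and dividing by \<open>sqrt n\<close>
  then standardizes it.\<close>

lemma distributed_standardized_sample_mean:
  assumes "n \<ge> 1"
  shows "distributed (sample_measure n \<theta>) lborel
    (\<lambda>y. sqrt (real n) * (sample_mean n y - \<theta>)) std_normal_density"
proof -
  interpret prob_space "sample_measure n \<theta>"
    by (rule prob_space_sample_measure)
  have "distributed (sample_measure n \<theta>) lborel (\<lambda>y. \<Sum>t=1..n. y t)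
      (normal_density (\<Sum>t=1..n. \<theta>) (sqrt (\<Sum>t=1..n. 1\<^sup>2)))"
    using assms
    by (intro sum_indep_normal indep_vars_sample_measure distributed_sample_measure) auto
  then have "distributed (sample_measure n \<theta>) lborel (\<lambda>y. \<Sum>t=1..n. y t)
      (normal_density (real n * \<theta>) (sqrt (real n)))"
    by simp
  then have "distributed (sample_measure n \<theta>) lborel
      (\<lambda>y. ((\<Sum>t=1..n. y t) - real n * \<theta>) / sqrt (real n)) std_normal_density"
    using assms by (subst (asm) normal_standard_normal_convert) auto
  moreover have "((\<Sum>t=1..n. y t) - real n * \<theta>) / sqrt (real n)
      = sqrt (real n) * (sample_mean n y - \<theta>)" for y
  proof -
    have "(\<Sum>t=1..n. y t) - real n * \<theta> = real n * (sample_mean n y - \<theta>)"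
      using assms by (simp add: sample_mean_def field_simps)
    then show ?thesis
      by (simp add: real_div_sqrt flip: times_divide_eq_left)
  qed
  ultimately show ?thesis
    by simp
qed

text \<open>Chebyshev for a variable of mean 0 and variance 1. The crude rate suffices, since
  \<open>a\<close> will be sent to infinity.\<close>

lemma prob_standardized_sample_mean_ge:
  assumes "n \<ge> 1" "a > 0"
  shows "measure (sample_measure n \<theta>)
      {y \<in> space (sample_measure n \<theta>). a \<le> \<bar>sqrt (real n) * (sample_mean n y - \<theta>)\<bar>} \<le> 1 / a\<^sup>2"
proof -
  interpret prob_space "sample_measure n \<theta>"
    by (rule prob_space_sample_measure)
  define Z where "Z y = sqrt (real n) * (sample_mean n y - \<theta>)" for y
  have D: "distributed (sample_measure n \<theta>) lborel Z std_normal_density"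
    using distributed_standardized_sample_mean[OF assms(1)] by (simp add: Z_def[abs_def])
  have Z: "Z \<in> borel_measurable (sample_measure n \<theta>)"
    using distributed_measurable[OF D] by simp
  \<comment> \<open>Chebyshev requires a finite second moment; it is transferred from the Gaussian
    density.\<close>
  have "integrable (sample_measure n \<theta>) (\<lambda>y. (Z y)\<^sup>2)"
    using integrable_std_normal_moment[of 2]
    by (subst distributed_integrable[OF D, of "\<lambda>z. z\<^sup>2", symmetric]) auto
  from Chebyshev_inequality[OF Z this assms(2)]
  have "prob {y \<in> space (sample_measure n \<theta>). a \<le> \<bar>Z y\<bar>} \<le> 1 / a\<^sup>2"
    unfolding standard_normal_distributed_variance[OF D]
    by (simp add: standard_normal_distributed_expectation[OF D])
  then show ?thesis
    by (simp add: Z_def)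
qed

lemma cdf_soft_dist:
  "cdf (soft_dist \<eta> n \<theta>) x = measure (sample_measure n \<theta>)
    {y \<in> space (sample_measure n \<theta>). sqrt (real n) * (soft_estimator \<eta> n y - \<theta>) \<le> x}"
proof -
  have [measurable]: "soft_estimator \<eta> n \<in> borel_measurable (sample_measure n \<theta>)"
    by (rule measurable_soft_estimator)
  show ?thesis
    unfolding cdf_def soft_dist_def
    by (subst measure_distr) (auto intro!: arg_cong[where f="measure _"])
qed

text \<open>An error of at most \<open>x\<close>, below \<open>- (sqrt n * \<theta>)\<close>, forces
  a negative estimate. Thresholding has then raised the sample mean by at least
  \<open>\<eta> n\<close>, so the standardized mean is at most \<open>x - sqrt n * \<eta> n\<close>,
  which is negative by the last hypothesis, and Chebyshev applies.\<close>

lemma cdf_soft_dist_le: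
  assumes "n \<ge> 1" "\<eta> n \<ge> 0" "x < - (sqrt (real n) * \<theta>)" "x < sqrt (real n) * \<eta> n"
  shows "cdf (soft_dist \<eta> n \<theta>) x \<le> 1 / (sqrt (real n) * \<eta> n - x)\<^sup>2"
proof -
  interpret prob_space "sample_measure n \<theta>"
    by (rule prob_space_sample_measure)
  have [measurable]: "sample_mean n \<in> borel_measurable (sample_measure n \<theta>)"
    by (rule borel_measurable_sample_mean)
  have s: "sqrt (real n) > 0"
    using assms(1) by simp
  have "sqrt (real n) * \<eta> n - x \<le> \<bar>sqrt (real n) * (sample_mean n y - \<theta>)\<bar>"
    if "sqrt (real n) * (soft_estimator \<eta> n y - \<theta>) \<le> x" for y
  proof -
    have "sqrt (real n) * soft_estimator \<eta> n y < 0"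
      using that assms(3) by (simp add: algebra_simps)
    then have "soft_estimator \<eta> n y < 0"
      using s by (simp add: mult_less_0_iff)
    \<comment> \<open>The lower bound is a minimum with 0; as the estimate is negative, that minimum
      cannot be 0.\<close>
    then have "sample_mean n y + \<eta> n \<le> soft_estimator \<eta> n y"
      using soft_threshold_ge[OF assms(2), of "sample_mean n y"]
      by (simp add: soft_estimator_def)
    then have "sqrt (real n) * (sample_mean n y + \<eta> n) \<le> sqrt (real n) * soft_estimator \<eta> n y"
      using s by simp
    then show ?thesis
      using that by (simp add: algebra_simps)
  qed
  then have "cdf (soft_dist \<eta> n \<theta>) x \<le> prob {y \<in> space (sample_measure n \<theta>).
      sqrt (real n) * \<eta> n - x \<le> \<bar>sqrt (real n) * (sample_mean n y - \<theta>)\<bar>}"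
    unfolding cdf_soft_dist by (intro finite_measure_mono) auto
  also have "\<dots> \<le> 1 / (sqrt (real n) * \<eta> n - x)\<^sup>2"
    using assms by (intro prob_standardized_sample_mean_ge) auto
  finally show ?thesis .
qed

text \<open>Mirror image of the preceding bound, applied to the complementary event: an error above
  \<open>x\<close> forces a positive estimate, hence a standardized mean above
  \<open>x + sqrt n * \<eta> n\<close>.\<close>

lemma cdf_soft_dist_ge:
  assumes "n \<ge> 1" "\<eta> n \<ge> 0" "- (sqrt (real n) * \<theta>) < x" "- x < sqrt (real n) * \<eta> n"
  shows "1 - 1 / (sqrt (real n) * \<eta> n + x)\<^sup>2 \<le> cdf (soft_dist \<eta> n \<theta>) x"
proof -
  interpret prob_space "sample_measure n \<theta>"
    by (rule prob_space_sample_measure)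
  have [measurable]: "sample_mean n \<in> borel_measurable (sample_measure n \<theta>)"
    by (rule borel_measurable_sample_mean)
  have [measurable]: "soft_estimator \<eta> n \<in> borel_measurable (sample_measure n \<theta>)"
    by (rule measurable_soft_estimator)
  have s: "sqrt (real n) > 0"
    using assms(1) by simp
  let ?A = "{y \<in> space (sample_measure n \<theta>).
    sqrt (real n) * (soft_estimator \<eta> n y - \<theta>) \<le> x}"
  have "sqrt (real n) * \<eta> n + x \<le> \<bar>sqrt (real n) * (sample_mean n y - \<theta>)\<bar>"
    if "\<not> sqrt (real n) * (soft_estimator \<eta> n y - \<theta>) \<le> x" for y
  proof -
    have "sqrt (real n) * soft_estimator \<eta> n y > 0"
      using that assms(3) by (simp add: algebra_simps)
    then have "soft_estimator \<eta> n y > 0"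
      using s by (simp add: zero_less_mult_iff)
    then have "soft_estimator \<eta> n y \<le> sample_mean n y - \<eta> n"
      using soft_threshold_le[OF assms(2), of "sample_mean n y"]
      by (simp add: soft_estimator_def)
    then have "sqrt (real n) * soft_estimator \<eta> n y \<le> sqrt (real n) * (sample_mean n y - \<eta> n)"
      using s by simp
    then show ?thesis
      using that by (simp add: algebra_simps)
  qed
  then have "prob (space (sample_measure n \<theta>) - ?A) \<le> prob {y \<in> space (sample_measure n \<theta>).
      sqrt (real n) * \<eta> n + x \<le> \<bar>sqrt (real n) * (sample_mean n y - \<theta>)\<bar>}"
    by (intro finite_measure_mono) auto
  also have "\<dots> \<le> 1 / (sqrt (real n) * \<eta> n + x)\<^sup>2"
    using assms by (intro prob_standardized_sample_mean_ge) auto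
  also have "prob (space (sample_measure n \<theta>) - ?A) = 1 - cdf (soft_dist \<eta> n \<theta>) x"
    unfolding cdf_soft_dist by (intro prob_compl) measurable
  finally show ?thesis
    by simp
qed

text \<open>The shift \<open>c\<close> absorbs the fixed evaluation point: it is \<open>- x\<close>
  in the upper bound for the cdf and \<open>x\<close> in the lower one.\<close>

lemma tendsto_inverse_square_at_top:
  fixes f :: "'a \<Rightarrow> real"
  assumes "filterlim f at_top F"
  shows "((\<lambda>n. 1 / (f n + c)\<^sup>2) \<longlongrightarrow> 0) F"
proof -
  have "filterlim (\<lambda>n. c + f n) at_top F"
    by (rule filterlim_tendsto_add_at_top[OF tendsto_const assms])
  then show ?thesis
    by (intro tendsto_divide_0[OF tendsto_const] filterlim_at_top_imp_at_infinity
        filterlim_pow_at_top) (auto simp: add.commute)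
qed

lemma cdf_soft_dist_tendsto_0:
  assumes "\<And>n. n \<ge> 1 \<Longrightarrow> \<eta> n \<ge> 0"
    and "filterlim (\<lambda>n. sqrt (real n) * \<eta> n) at_top sequentially"
    and "\<forall>\<^sub>F n in sequentially. sqrt (real n) * \<theta> n < - x"
  shows "(\<lambda>n. cdf (soft_dist \<eta> n (\<theta> n)) x) \<longlonglongrightarrow> 0"
proof (rule tendsto_sandwich[OF _ _ tendsto_const tendsto_inverse_square_at_top[OF assms(2)]])
  show "\<forall>\<^sub>F n in sequentially. 0 \<le> cdf (soft_dist \<eta> n (\<theta> n)) x"
    by (simp add: cdf_def)
  \<comment> \<open>Divergence of the scaled threshold eventually makes the Chebyshev radius
    positive.\<close>
  have "\<forall>\<^sub>F n in sequentially. x < sqrt (real n) * \<eta> n"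
    using assms(2) by (simp add: filterlim_at_top_dense)
  then show "\<forall>\<^sub>F n in sequentially.
      cdf (soft_dist \<eta> n (\<theta> n)) x \<le> 1 / (sqrt (real n) * \<eta> n + - x)\<^sup>2"
    using assms(3) eventually_ge_at_top[of 1]
  proof eventually_elim
    case (elim n)
    then show ?case
      using cdf_soft_dist_le[of n \<eta> x "\<theta> n"] assms(1)[of n] by simp
  qed
qed

lemma cdf_soft_dist_tendsto_1:
  assumes "\<And>n. n \<ge> 1 \<Longrightarrow> \<eta> n \<ge> 0"
    and "filterlim (\<lambda>n. sqrt (real n) * \<eta> n) at_top sequentially"
    and "\<forall>\<^sub>F n in sequentially. - x < sqrt (real n) * \<theta> n"
  shows "(\<lambda>n. cdf (soft_dist \<eta> n (\<theta> n)) x) \<longlonglongrightarrow> 1"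
proof (rule tendsto_sandwich[OF _ _ _ tendsto_const])
  show "(\<lambda>n. 1 - 1 / (sqrt (real n) * \<eta> n + x)\<^sup>2) \<longlonglongrightarrow> 1"
    using tendsto_diff[OF tendsto_const tendsto_inverse_square_at_top[OF assms(2)]] by simp
  show "\<forall>\<^sub>F n in sequentially. cdf (soft_dist \<eta> n (\<theta> n)) x \<le> 1"
    by (simp add: real_distribution.cdf_bounded_prob[OF real_distribution_soft_dist])
  have "\<forall>\<^sub>F n in sequentially. - x < sqrt (real n) * \<eta> n"
    using assms(2) by (simp add: filterlim_at_top_dense)
  then show "\<forall>\<^sub>F n in sequentially.
      1 - 1 / (sqrt (real n) * \<eta> n + x)\<^sup>2 \<le> cdf (soft_dist \<eta> n (\<theta> n)) x"
    using assms(3) eventually_ge_at_top[of 1]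
  proof eventually_elim
    case (elim n)
    then show ?case
      using cdf_soft_dist_ge[of n \<eta> "\<theta> n" x] assms(1)[of n] by simp
  qed
qed

lemma cdf_return: "cdf (return borel a) x = (if a \<le> x then 1 else 0)"
  by (simp add: cdf_def measure_return indicator_def)

text \<open>Weak convergence tests only continuity points of the limit cdf, and a point mass at
  \<open>a\<close> has its single jump there, so convergence at \<open>x = a\<close> is never asked
  for.\<close>

lemma weak_conv_m_return:
  assumes "\<And>x. x < a \<Longrightarrow> (\<lambda>n. cdf (M n) x) \<longlonglongrightarrow> 0"
    and "\<And>x. a < x \<Longrightarrow> (\<lambda>n. cdf (M n) x) \<longlonglongrightarrow> 1"
  shows "weak_conv_m M (return borel a)"
  unfolding weak_conv_m_def weak_conv_def
proof (intro allI impI)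
  fix x
  assume cont: "isCont (cdf (return borel a)) x"
  interpret real_distribution "return borel a"
    by (intro real_distribution.intro real_distribution_axioms.intro prob_space_return) auto
  \<comment> \<open>A cdf is continuous at a point exactly when that point has mass zero, whereas
    \<open>a\<close> has mass 1.\<close>
  have "x \<noteq> a"
    using cont by (auto simp: isCont_cdf measure_return)
  then show "(\<lambda>n. cdf (M n) x) \<longlonglongrightarrow> cdf (return borel a) x"
    using assms[of x] by (auto simp: cdf_return)
qed

theorem theorem10:
  fixes \<eta> \<theta> :: "nat \<Rightarrow> real" and \<nu> :: ereal
  assumes "\<And>n. n \<ge> 1 \<Longrightarrow> \<eta> n > 0"
    and "\<eta> \<longlonglongrightarrow> 0"
    and "filterlim (\<lambda>n. sqrt (real n) * \<eta> n) at_top sequentially"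
    and "(\<lambda>n. ereal (sqrt (real n) * \<theta> n)) \<longlonglongrightarrow> \<nu>"
  shows "(\<forall>r. \<nu> = ereal r \<longrightarrow>
            weak_conv_m (\<lambda>n. soft_dist \<eta> n (\<theta> n)) (return borel (- r))) \<and>
         (- \<nu> = \<infinity> \<longrightarrow> (\<forall>x. (\<lambda>n. cdf (soft_dist \<eta> n (\<theta> n)) x) \<longlonglongrightarrow> 0)) \<and>
         (- \<nu> = - \<infinity> \<longrightarrow> (\<forall>x. (\<lambda>n. cdf (soft_dist \<eta> n (\<theta> n)) x) \<longlonglongrightarrow> 1))"
proof -
  have nonneg: "\<eta> n \<ge> 0" if "n \<ge> 1" for n
    using assms(1)[OF that] by simp
  \<comment> \<open>Comparing in \<open>ereal\<close> treats all limits alike: a strict inequality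
    for \<open>\<nu>\<close> passes to the sequence eventually. For finite \<open>\<nu>\<close> it
    separates the two sides of the atom; for \<open>\<nu> = - \<infinity>\<close> it holds at every
    real \<open>x\<close>.\<close>
  have to_0: "(\<lambda>n. cdf (soft_dist \<eta> n (\<theta> n)) x) \<longlonglongrightarrow> 0" if "\<nu> < ereal (- x)" for x
    using order_tendstoD(2)[OF assms(4) that]
    by (intro cdf_soft_dist_tendsto_0[OF nonneg assms(3)]) auto
  have to_1: "(\<lambda>n. cdf (soft_dist \<eta> n (\<theta> n)) x) \<longlonglongrightarrow> 1" if "ereal (- x) < \<nu>" for x
    using order_tendstoD(1)[OF assms(4) that]
    by (intro cdf_soft_dist_tendsto_1[OF nonneg assms(3)]) auto
  show ?thesis
  proof (intro conjI allI impI)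
    fix r
    assume "\<nu> = ereal r"
    then show "weak_conv_m (\<lambda>n. soft_dist \<eta> n (\<theta> n)) (return borel (- r))"
      by (intro weak_conv_m_return to_0 to_1) auto
  next
    fix x
    assume "- \<nu> = \<infinity>"
    then have "\<nu> = - \<infinity>"
      by (simp add: ereal_uminus_eq_reorder)
    then show "(\<lambda>n. cdf (soft_dist \<eta> n (\<theta> n)) x) \<longlonglongrightarrow> 0"
      by (intro to_0) simp
  next
    fix x
    assume "- \<nu> = - \<infinity>"
    then show "(\<lambda>n. cdf (soft_dist \<eta> n (\<theta> n)) x) \<longlonglongrightarrow> 1"
      by (intro to_1) simp
  qed
qed

end
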